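(* Let the function $x\mapsto\psi_p(x)$ be lower semicontinuous at $\bar x$ and let $t\mapsto\psi_p^t(x)$ be upper semicontinuous at $0^+$ for all $x\in\mathbb{R}^n$. Furthermore, let $t_k\downarrow0$ and let $(x^k)_k$ be a sequence such that, for each $k$, $x^k$ is a global optimal solution of the problem $\min_{x\in X}\psi_p^{t_k}(x)$. If $(x^k)_k$ admits a subsequence converging to the point $\bar x$, then $\bar x$ is a global optimal solution of the problem $\min_{x\in X}\psi_p(x)$.
   Context: Setting. $F,f:\mathbb{R}^n\times\mathbb{R}^m\to\mathbb{R}$, $G:\mathbb{R}^n\to\mathbb{R}^p$, $g:\mathbb{R}^n\times\mathbb{R}^m\to\mathbb{R}^q$ are twice continuously differentiable. Let $X=\{x\in\mathbb{R}^n: G(x)\le 0\}$ and $S(x)=\arg\min_y\{f(x,y): g(x,y)\le 0\}$. Standing assumptions: $S(x)\neq\varnothing$ if $x\in X$ and $S(x)=\varnothing$ otherwise; $f$ and $g_1,\dots,g_q$ are convex in $y$; Slater condition: for every $x\in X$ there is $y(x)\in\mathbb{R}^m$ with $g_i(x,y(x))<0$ for all $i$. Let $\mathcal{L}(x,y,u)=\nabla_y f(x,y)+\sum_{i=1}^q u_i\nabla_y g_i(x,y)$ and $\mathcal{D}(x)=\{(y,u)\in\mathbb{R}^{m+q}: \mathcal{L}(x,y,u)=0,\ u\ge 0,\ g(x,y)\le 0,\ u^\top g(x,y)=0\}$; for $t>0$, $\mathcal{D}^t(x)=\{(y,u)\in\mathbb{R}^{m+q}: \mathcal{L}(x,y,u)=0,\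 u\ge 0,\ g(x,y)\le 0,\ -u_ig_i(x,y)\le t,\ i=1,\dots,q\}$, assumed nonempty throughout. Put $\psi_p(x)=\max_{(y,u)\in\mathcal{D}(x)}F(x,y)$ and $\psi_p^t(x)=\max_{(y,u)\in\mathcal{D}^t(x)}F(x,y)$ (optimal value functions; the value is understood as the supremum). By convention $\psi_p^0=\psi_p$, so upper semicontinuity of $t\mapsto\psi^t_p(x)$ at $0^+$ means $\limsup_{t\downarrow0}\psi_p^t(x)\le\psi_p(x)$. $t_k\downarrow 0$ means a sequence of positive numbers decreasing to $0$. A point $\bar x\in X$ is a global optimal solution of $\min_{x\in X}\psi(x)$ if $\psi(\bar x)\le\psi(x)$ for all $x\in X$. *)

theory Defs
  imports "HOL-Analysis.Analysis"
begin

definition C2 :: "('a::real_normed_vector \<Rightarrow> 'b::real_normed_vector) \<Rightarrow> bool" where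
  "C2 h \<longleftrightarrow> (\<exists>(h' :: 'a \<Rightarrow> 'a \<Rightarrow>\<^sub>L 'b) (h'' :: 'a \<Rightarrow> 'a \<Rightarrow>\<^sub>L 'a \<Rightarrow>\<^sub>L 'b).
     (\<forall>x. (h has_derivative blinfun_apply (h' x)) (at x)) \<and>
     (\<forall>x. (h' has_derivative blinfun_apply (h'' x)) (at x)) \<and>
     continuous_on UNIV h'')"

definition grad :: "('a::real_inner \<Rightarrow> real) \<Rightarrow> 'a \<Rightarrow> 'a" where
  "grad h y = (THE D. GDERIV h y :> D)"

lemma grad_eqI: "grad h y = D" if "GDERIV h y :> D"
  unfolding grad_def
proof (rule the_equality)
  fix D' assume "GDERIV h y :> D'"
  with that have "(\<lambda>z. z \<bullet> D) = (\<lambda>z. z \<bullet> D')"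
    unfolding gderiv_def by (rule has_derivative_unique)
  then have "\<forall>z. z \<bullet> D' = z \<bullet> D"
    by (simp add: fun_eq_iff)
  then show "D' = D"
    by (simp only: vector_eq_ldot)
qed (fact that)

text \<open>Inequalities between vectors of \<open>real ^ 'k\<close> are componentwise, as in the library order.\<close>

definition upper_feasible :: "(real ^ 'n \<Rightarrow> real ^ 'p) \<Rightarrow> (real ^ 'n) set" where
  "upper_feasible G = {x. G x \<le> 0}"

definition lower_solutions ::
  "((real ^ 'n) \<times> (real ^ 'm) \<Rightarrow> real) \<Rightarrow> ((real ^ 'n) \<times> (real ^ 'm) \<Rightarrow> real ^ 'q) \<Rightarrow>
   real ^ 'n \<Rightarrow> (real ^ 'm) set" where
  "lower_solutions f g x = {y. is_arg_min (\<lambda>y. f (x, y)) (\<lambda>y. g (x, y) \<le> 0) y}"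

text \<open>The function \<open>\<L>\<close>: the gradient in \<open>y\<close> of the lower-level Lagrangian.\<close>

definition lagr_grad ::
  "((real ^ 'n) \<times> (real ^ 'm) \<Rightarrow> real) \<Rightarrow> ((real ^ 'n) \<times> (real ^ 'm) \<Rightarrow> real ^ 'q) \<Rightarrow>
   real ^ 'n \<Rightarrow> real ^ 'm \<Rightarrow> real ^ 'q \<Rightarrow> real ^ 'm" where
  "lagr_grad f g x y u =
     grad (\<lambda>y. f (x, y)) y + (\<Sum>i\<in>UNIV. (u $ i) *\<^sub>R grad (\<lambda>y. g (x, y) $ i) y)"

definition kkt_set ::
  "((real ^ 'n) \<times> (real ^ 'm) \<Rightarrow> real) \<Rightarrow> ((real ^ 'n) \<times> (real ^ 'm) \<Rightarrow> real ^ 'q) \<Rightarrow>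
   real ^ 'n \<Rightarrow> ((real ^ 'm) \<times> (real ^ 'q)) set" where
  "kkt_set f g x = {(y, u). lagr_grad f g x y u = 0 \<and> 0 \<le> u \<and> g (x, y) \<le> 0 \<and>
     u \<bullet> g (x, y) = 0}"

definition kkt_set_relaxed ::
  "((real ^ 'n) \<times> (real ^ 'm) \<Rightarrow> real) \<Rightarrow> ((real ^ 'n) \<times> (real ^ 'm) \<Rightarrow> real ^ 'q) \<Rightarrow>
   real \<Rightarrow> real ^ 'n \<Rightarrow> ((real ^ 'm) \<times> (real ^ 'q)) set" where
  "kkt_set_relaxed f g t x = {(y, u). lagr_grad f g x y u = 0 \<and> 0 \<le> u \<and> g (x, y) \<le> 0 \<and>
     (\<forall>i. - (u $ i * g (x, y) $ i) \<le> t)}"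

text \<open>The optimal values are suprema in the extended reals, so the value is \<open>\<infinity>\<close> if the
  objective is unbounded above and \<open>-\<infinity>\<close> if the feasible set is empty.\<close>

definition psi ::
  "((real ^ 'n) \<times> (real ^ 'm) \<Rightarrow> real) \<Rightarrow> ((real ^ 'n) \<times> (real ^ 'm) \<Rightarrow> real) \<Rightarrow>
   ((real ^ 'n) \<times> (real ^ 'm) \<Rightarrow> real ^ 'q) \<Rightarrow> real ^ 'n \<Rightarrow> ereal" where
  "psi F f g x = (SUP (y, u) \<in> kkt_set f g x. ereal (F (x, y)))"

definition psi_relaxed ::
  "((real ^ 'n) \<times> (real ^ 'm) \<Rightarrow> real) \<Rightarrow> ((real ^ 'n) \<times> (real ^ 'm) \<Rightarrow> real) \<Rightarrow>
   ((real ^ 'n) \<times> (real ^ 'm) \<Rightarrow> real ^ 'q) \<Rightarrow> real \<Rightarrow> real ^ 'n \<Rightarrow> ereal" where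
  "psi_relaxed F f g t x = (SUP (y, u) \<in> kkt_set_relaxed f g t x. ereal (F (x, y)))"

definition global_opt :: "'a set \<Rightarrow> ('a \<Rightarrow> ereal) \<Rightarrow> 'a \<Rightarrow> bool" where
  "global_opt X \<phi> z \<longleftrightarrow> z \<in> X \<and> (\<forall>x\<in>X. \<phi> z \<le> \<phi> x)"

text \<open>Lower semicontinuity at \<open>z\<close> relative to \<open>X\<close>.  For \<open>psi\<close> the relevant \<open>X\<close> is
  \<open>upper_feasible G\<close>, its effective domain: outside of it, since the
  lower-level problem is convex and has no solution, \<open>kkt_set f g x\<close> is empty and \<open>psi\<close> takes the value \<open>-\<infinity>\<close>, so lower semicontinuity relative to the whole space would
  fail at every boundary point of \<open>X\<close>.\<close>

definition lsc_at :: "'a::topological_space set \<Rightarrow> ('a \<Rightarrow> ereal) \<Rightarrow> 'a \<Rightarrow> bool" where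
  "lsc_at X \<phi> z \<longleftrightarrow> \<phi> z \<le> Liminf (at z within X) \<phi>"

text \<open>Upper semicontinuity at \<open>0\<^sup>+\<close> of a family of values over \<open>t > 0\<close>, where \<open>v\<close> is
  the value assigned to \<open>t = 0\<close> by convention.\<close>

definition usc_at_zero_plus :: "(real \<Rightarrow> ereal) \<Rightarrow> ereal \<Rightarrow> bool" where
  "usc_at_zero_plus h v \<longleftrightarrow> Limsup (at_right 0) h \<le> v"

end

(* Suppose psi z < c < psi xbar for a feasible z. Lower semicontinuity gives c < psi (x k) along the
   subsequence, and the Karush-Kuhn-Tucker set lies in its relaxation, so
   psi (x k) \<le> psi_relaxed (t k) (x k) \<le> psi_relaxed (t k) z by optimality of x k. Upper
   semicontinuity in t makes the right-hand side eventually less than c, a contradiction. *)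
theory Submission
  imports Defs
begin

lemma C2_imp_continuous_on: "C2 h \<Longrightarrow> continuous_on A h"
  unfolding C2_def
  by (meson continuous_at_imp_continuous_on has_derivative_continuous)

lemma closed_upper_feasible:
  assumes "continuous_on UNIV G"
  shows "closed (upper_feasible G)"
proof -
  have "upper_feasible G = (\<Inter>i. {x. G x $ i \<le> 0})"
    by (auto simp: upper_feasible_def less_eq_vec_def)
  moreover have "closed {x. G x $ i \<le> 0}" for i
    by (intro closed_Collect_le continuous_intros assms)
  ultimately show ?thesis
    by auto
qed

text \<open>Under the sign conditions every product \<open>- (u $ j * g (x, y) $ j)\<close> is
  nonnegative; complementarity says that they sum to zero, so each one vanishes and is bounded by
  \<open>t\<close>.\<close>

lemma kkt_set_subset_relaxed:
  assumes "t \<ge> 0"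
  shows "kkt_set f g x \<subseteq> kkt_set_relaxed f g t x"
proof (clarsimp simp: kkt_set_def kkt_set_relaxed_def)
  fix y u i
  assume u: "0 \<le> u" and g: "g (x, y) \<le> 0" and "u \<bullet> g (x, y) = 0"
  then have "(\<Sum>j\<in>UNIV. - (u $ j * g (x, y) $ j)) = 0"
    by (simp add: inner_vec_def sum_negf)
  moreover have "0 \<le> - (u $ j * g (x, y) $ j)" for j
    using u g by (simp add: less_eq_vec_def mult_nonneg_nonpos)
  ultimately have "- (u $ i * g (x, y) $ i) = 0"
    by (simp add: sum_nonneg_eq_0_iff)
  with assms show "- (u $ i * g (x, y) $ i) \<le> t"
    by linarith
qed

lemma psi_le_psi_relaxed:
  "t \<ge> 0 \<Longrightarrow> psi F f g x \<le> psi_relaxed F f g t x"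
  unfolding psi_def psi_relaxed_def
  by (rule SUP_subset_mono[OF kkt_set_subset_relaxed]) auto

text \<open>The filter \<open>at z within X\<close> omits \<open>z\<close> itself, but there the value exceeds \<open>c\<close> by
  hypothesis, so the sequence may also visit \<open>z\<close>.\<close>

lemma lsc_at_sequentially:
  assumes lsc: "lsc_at X \<phi> z" and "c < \<phi> z" and lim: "w \<longlonglongrightarrow> z" and "\<And>k. w k \<in> X"
  shows "\<forall>\<^sub>F k in sequentially. c < \<phi> (w k)"
proof -
  have "c < Liminf (at z within X) \<phi>"
    using assms by (auto simp: lsc_at_def)
  then have "\<forall>\<^sub>F v in at z within X. c < \<phi> v"
    by (rule less_LiminfD)
  then have "\<forall>\<^sub>F v in nhds z. v \<in> X \<longrightarrow> c < \<phi> v"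
    unfolding eventually_at_filter using \<open>c < \<phi> z\<close> by (auto elim: eventually_mono)
  with lim have "\<forall>\<^sub>F k in sequentially. w k \<in> X \<longrightarrow> c < \<phi> (w k)"
    by (rule eventually_compose_filterlim[rotated])
  with assms(4) show ?thesis
    by simp
qed

text \<open>Positivity of \<open>s\<close> makes it approach 0 from the right, so it eventually
  enters the right neighbourhood of 0 on which the strict bound on the \<open>Limsup\<close> is
  effective.\<close>

lemma usc_at_zero_plus_sequentially:
  assumes "usc_at_zero_plus h v" and "v < c" and "s \<longlonglongrightarrow> 0" and "\<And>k. s k > 0"
  shows "\<forall>\<^sub>F k in sequentially. h (s k) < c"
proof -
  have "Limsup (at_right 0) h < c"
    using assms by (auto simp: usc_at_zero_plus_def)
  then have "\<forall>\<^sub>F r in at_right 0. h r < c"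
    by (rule Limsup_lessD)
  moreover have "filterlim s (at_right 0) sequentially"
    using assms by (intro tendsto_imp_filterlim_at_right) auto
  ultimately show ?thesis
    by (rule eventually_compose_filterlim)
qed

theorem theorem3p1:
  fixes F f :: "(real ^ 'n) \<times> (real ^ 'm) \<Rightarrow> real"
    and G :: "real ^ 'n \<Rightarrow> real ^ 'p"
    and g :: "(real ^ 'n) \<times> (real ^ 'm) \<Rightarrow> real ^ 'q"
    and t :: "nat \<Rightarrow> real" and x :: "nat \<Rightarrow> real ^ 'n" and xbar :: "real ^ 'n"
  assumes smooth: "C2 F" "C2 f" "C2 G" "C2 g"
    and solvable: "\<forall>z. lower_solutions f g z \<noteq> {} \<longleftrightarrow> z \<in> upper_feasible G"
    and convex_f: "\<forall>z. convex_on UNIV (\<lambda>y. f (z, y))"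
    and convex_g: "\<forall>z i. convex_on UNIV (\<lambda>y. g (z, y) $ i)"
    and slater: "\<forall>z\<in>upper_feasible G. \<exists>y. \<forall>i. g (z, y) $ i < 0"
    and nonempty: "\<forall>z\<in>upper_feasible G. \<forall>s>0. kkt_set_relaxed f g s z \<noteq> {}"
    and lsc: "lsc_at (upper_feasible G) (psi F f g) xbar"
    and usc: "\<forall>z. usc_at_zero_plus (\<lambda>s. psi_relaxed F f g s z) (psi F f g z)"
    and t_pos: "\<forall>k. t k > 0" and t_decseq: "decseq t" and t_lim: "t \<longlonglongrightarrow> 0"
    and opt: "\<forall>k. global_opt (upper_feasible G) (psi_relaxed F f g (t k)) (x k)"
    and subseq: "\<exists>r. strict_mono r \<and> (x \<circ> r) \<longlonglongrightarrow> xbar"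
  shows "global_opt (upper_feasible G) (psi F f g) xbar"
proof -
  let ?X = "upper_feasible G"
  obtain r where r: "strict_mono r" "(x \<circ> r) \<longlonglongrightarrow> xbar"
    using subseq by blast
  have x_in: "x k \<in> ?X" and x_le: "z \<in> ?X \<Longrightarrow> psi_relaxed F f g (t k) (x k) \<le> psi_relaxed F f g (t k) z"
    for k z
    using opt by (auto simp: global_opt_def)
  \<comment> \<open>Feasibility of \<open>xbar\<close> is part of the claim; it passes to the limit
    from the feasible points \<open>x (r k)\<close>.\<close>
  have "closed ?X"
    using smooth(3) by (intro closed_upper_feasible C2_imp_continuous_on)
  then have "xbar \<in> ?X"
    by (rule closed_sequentially[OF _ _ r(2)]) (simp add: x_in)
  moreover have "psi F f g xbar \<le> psi F f g z" if z: "z \<in> ?X" for z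
  proof (rule ccontr)
    assume "\<not> psi F f g xbar \<le> psi F f g z"
    \<comment> \<open>The order on \<open>ereal\<close> is dense, so \<open>c\<close> exists even if
      one of the two values is infinite.\<close>
    then obtain c where c: "psi F f g z < c" "c < psi F f g xbar"
      by (meson dense not_le)
    have "\<forall>\<^sub>F k in sequentially. c < psi F f g ((x \<circ> r) k)"
      by (rule lsc_at_sequentially[OF lsc c(2) r(2)]) (simp add: x_in)
    \<comment> \<open>Only the parameter varies here: semicontinuity in \<open>t\<close> is used at
      the fixed competitor \<open>z\<close>, along the subsequence \<open>t \<circ> r\<close>, which
      still tends to 0.\<close>
    moreover have "\<forall>\<^sub>F k in sequentially. psi_relaxed F f g ((t \<circ> r) k) z < c"
      by (rule usc_at_zero_plus_sequentially[OF usc[rule_format] c(1)])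
        (use t_pos LIMSEQ_subseq_LIMSEQ[OF t_lim r(1)] in \<open>auto simp: o_def\<close>)
    \<comment> \<open>Both bounds hold for all large \<open>k\<close>, and a single such index
      already gives the contradiction.\<close>
    ultimately have "\<forall>\<^sub>F k in sequentially. False"
    proof eventually_elim
      case (elim k)
      have "psi F f g (x (r k)) \<le> psi_relaxed F f g (t (r k)) (x (r k))"
        using t_pos by (intro psi_le_psi_relaxed less_imp_le) simp
      also have "\<dots> \<le> psi_relaxed F f g (t (r k)) z"
        by (rule x_le[OF z])
      finally show False
        using elim by simp
    qed
    then show False
      by simp
  qed
  ultimately show ?thesis
    by (simp add: global_opt_def)
qed

end
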